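(* Let $A\in\mathbb{C}^{n\times n}$. If $S$ is a complete structural set of $A$ (i.e. $S\in st_0(A)$), then the nonzero eigenvalues of $A$ are contained in the set $\mathcal{E}(A_S)$, where $A_S$ is the weighted adjacency matrix of the isospectral reduction over $S$ of the weighted digraph with weighted adjacency matrix $A$. Moreover, $\mathcal{E}(A_S)\subseteq\mathcal{E}(A)$.
   Context: Rational functions. $\mathbb{C}[\lambda]$ is the set of complex polynomials in $\lambda$, and $\mathbb{W}[\lambda]$ is the set of rational functions $p/q$ with $p,q\in\mathbb{C}[\lambda]$, $q\neq 0$. $\mathbb{W}[\lambda]^{n\times n}$ is the set of $n\times n$ matrices with entries in $\mathbb{W}[\lambda]$; complex matrices are regarded as matrices of constant rational functions. Graphs. A weighted digraph $G=(V,E,\omega)$ has vertex set $V=\{v_1,\dots,v_n\}$, edge set $E$, and weight function $\omega$ with values in $\mathbb{W}[\lambda]$; $e_{ij}$ denotes the edge from $v_i$ to $v_j$. Every edge has nonzero weight, and $\omega(e_{ij})=0$ is used when $e_{ij}\notin E$. The weighted adjacency matrix of $G$ is $M(G)\in\mathbb{W}[\lambda]^{n\times n}$ with $M(G)_{ij}=\omega(e_{ij})$. The graph associated with a matrix $A$ is the graph $G$ with $M(G)=A$ (so $e_{ij}\in E$ iff $A_{ij}\neq 0$). Paths and cycles. A path is an ordered sequence of distinct vertices $u_1,\dots,u_m$ of $V$ such that there is an edge from $u_i$ to $u_{i+1}$ for $1\le i\le m-1$; its interior vertices are $u_2,\dots,u_{m-1}$. If instead $u_1=u_m$ (all the other vertices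 being distinct from each other and from $u_1$) the sequence is a cycle, with the same notion of interior vertices. A loop is a cycle consisting of the single edge $e_{ii}$ from a vertex $v_i$ to itself. Branches. For a nonempty set $S\subseteq V$ and $v_i,v_j\in S$, $\mathcal{B}_{ij}(G;S)$ is the set of paths or cycles from $v_i$ to $v_j$ having no interior vertex in $S$. An element of $\mathcal{B}_S(G)=\bigcup_{v_i,v_j\in S}\mathcal{B}_{ij}(G;S)$ is called a branch of $G$ with respect to $S$. In particular, for $v_i,v_j\in S$ with $e_{ij}\in E$, the edge $e_{ij}$ itself (a loop if $i=j$) gives a branch in $\mathcal{B}_{ij}(G;S)$ with no interior vertices. Complete structural sets. Write $\bar S=V\setminus S$. A nonempty set $S\subseteq V$ is a complete structural set of $G$, written $S\in st_0(G)$, if (i) each cycle of $G$, including loops, contains a vertex in $S$; (ii) $\omega(e_{ii})\neq\lambda$ (the rational function $\lambda/1$) for each $v_i\in\bar S$; and (iii) each vertex of $V$ belongs to a branch in $\mathcal{B}_S(G)$. If $A$ is the weighted adjacency matrix of $G$, write $S\in st_0(A)$ whenever $S\in st_0(G)$. Isospectral reduction. For a branch $\beta=u_1,\dots,u_m$ with at least one interior vertex, its branch product is $$\mathcal{P}_\omega(\beta)=\omega(u_1u_2)\prod_{k=2}^{m-1}\frac{\omega(u_ku_{k+1})}{\lambda-\omega(u_ku_k)},$$ where $\omega(uv)$ is the weight of the edge from $u$ to $v$ (and is $0$ if there is no such edge). For a branch with no interior vertices, consisting of a single edge (possibly a loop), $\mathcal{P}_\omega(\beta)$ is the weight of that edge.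 The isospectral reduction of $G$ over $S$ is the graph $\mathcal{R}_S(G)=(S,\mathcal{E},\mu)$ with vertex set $S$, weights $$\mu(e_{ij})=\sum_{\beta\in\mathcal{B}_{ij}(G;S)}\mathcal{P}_\omega(\beta)\quad (v_i,v_j\in S),$$ taken to be $0$ if $\mathcal{B}_{ij}(G;S)=\emptyset$, and with $e_{ij}$ an edge iff $\mu(e_{ij})\neq 0$. If $A=M(G)$, then $A_S=M(\mathcal{R}_S(G))$, a matrix with entries in $\mathbb{W}[\lambda]$ whose rows and columns are indexed by $S$. Gershgorin-type region. For $B\in\mathbb{W}[\lambda]^{\ell\times\ell}$, $$\mathcal{E}(B)=\bigcup_{i=1}^{\ell}\Big\{\lambda\in\mathbb{C}:\ |\lambda-B_{ii}(\lambda)|\le\sum_{j=1,\,j\neq i}^{\ell}|B_{ij}(\lambda)|\Big\},$$ where the $i$-th inequality is considered at those $\lambda$ at which the entries of the $i$-th row of $B$ are defined. For a complex matrix this is the usual union of Gershgorin discs. *)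

theory Defs
  imports
    Complex_Main
    "HOL-Computational_Algebra.Polynomial_Factorial"
    "Jordan_Normal_Form.Char_Poly"
begin

type_synonym ratfun = "complex poly fract"

abbreviation ratfun_const :: "complex \<Rightarrow> ratfun" where
  "ratfun_const c \<equiv> to_fract [:c:]"

abbreviation ratfun_var :: ratfun where
  "ratfun_var \<equiv> to_fract [:0, 1:]"

text \<open>A rational function is an element of the fraction field, so it is defined at a point iff
  one of its representations \<open>p / q\<close> (equivalently, the one in lowest terms) has a denominator
  not vanishing there.\<close>

definition ratfun_value :: "ratfun \<Rightarrow> complex \<Rightarrow> complex \<Rightarrow> bool" where
  "ratfun_value f z w \<longleftrightarrow>
     (\<exists>p q. f = Fract p q \<and> poly q z \<noteq> 0 \<and> w = poly p z / poly q z)"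

definition ratfun_defined :: "ratfun \<Rightarrow> complex \<Rightarrow> bool" where
  "ratfun_defined f z \<longleftrightarrow> (\<exists>w. ratfun_value f z w)"

definition ratfun_eval :: "ratfun \<Rightarrow> complex \<Rightarrow> complex" where
  "ratfun_eval f z = (THE w. ratfun_value f z w)"

lemma ratfun_value_unique:
  assumes "ratfun_value f z w" "ratfun_value f z w'"
  shows "w = w'"
proof -
  obtain p q where 1: "f = Fract p q" "poly q z \<noteq> 0" "w = poly p z / poly q z"
    using assms(1) by (auto simp: ratfun_value_def)
  obtain p' q' where 2: "f = Fract p' q'" "poly q' z \<noteq> 0" "w' = poly p' z / poly q' z"
    using assms(2) by (auto simp: ratfun_value_def)
  have "q \<noteq> 0" "q' \<noteq> 0" using 1 2 by auto
  then have "p * q' = p' * q" using 1 2 by (simp add: eq_fract)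
  then have "poly p z * poly q' z = poly p' z * poly q z" by (metis poly_mult)
  then show ?thesis using 1 2 by (simp add: frac_eq_eq)
qed

lemma ratfun_eval_eq: "ratfun_value f z w \<Longrightarrow> ratfun_eval f z = w"
  unfolding ratfun_eval_def using ratfun_value_unique by blast

lemma ratfun_eval_Fract: "poly q z \<noteq> 0 \<Longrightarrow> ratfun_eval (Fract p q) z = poly p z / poly q z"
  by (rule ratfun_eval_eq) (auto simp: ratfun_value_def)

lemma ratfun_defined_Fract: "poly q z \<noteq> 0 \<Longrightarrow> ratfun_defined (Fract p q) z"
  by (auto simp: ratfun_defined_def ratfun_value_def)

lemma ratfun_defined_const: "ratfun_defined (ratfun_const c) z"
  using ratfun_defined_Fract[of 1 z "[:c:]"] by (simp add: to_fract_def)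

lemma ratfun_eval_const: "ratfun_eval (ratfun_const c) z = c"
  using ratfun_eval_Fract[of 1 z "[:c:]"] by (simp add: to_fract_def)

text \<open>Since an edge is present exactly when its weight is nonzero, the edge set is derived from
  the vertex set and the weight function. Values of \<open>weight\<close> outside the vertex set are ignored.\<close>

record 'v wdigraph =
  verts :: "'v set"
  weight :: "'v \<Rightarrow> 'v \<Rightarrow> ratfun"

definition edges :: "'v wdigraph \<Rightarrow> ('v \<times> 'v) set" where
  "edges G = {(u, v). u \<in> verts G \<and> v \<in> verts G \<and> weight G u v \<noteq> 0}"

text \<open>The vertices index the rows and columns in increasing order.\<close>

definition adj_mat :: "'v::linorder wdigraph \<Rightarrow> ratfun mat" where
  "adj_mat G = (let vs = sorted_list_of_set (verts G) in
     mat (card (verts G)) (card (verts G)) (\<lambda>(i, j). weight G (vs ! i) (vs ! j)))"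

definition mat_graph :: "ratfun mat \<Rightarrow> nat wdigraph" where
  "mat_graph B = \<lparr>verts = {0..<dim_row B},
     weight = (\<lambda>i j. if i < dim_row B \<and> j < dim_row B then B $$ (i, j) else 0)\<rparr>"

lemma adj_mat_mat_graph: "B \<in> carrier_mat n n \<Longrightarrow> adj_mat (mat_graph B) = B"
  by (rule eq_matI) (auto simp: adj_mat_def mat_graph_def Let_def)

text \<open>A walk is given by its list of vertices and has at least one edge; thus a single vertex is
  neither a path nor a cycle, whereas a loop at \<open>v\<close> is the cycle \<open>[v, v]\<close>.\<close>

definition walk :: "'v wdigraph \<Rightarrow> 'v list \<Rightarrow> bool" where
  "walk G us \<longleftrightarrow> 2 \<le> length us \<and> (\<forall>k. Suc k < length us \<longrightarrow> (us ! k, us ! Suc k) \<in> edges G)"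

definition path :: "'v wdigraph \<Rightarrow> 'v list \<Rightarrow> bool" where
  "path G us \<longleftrightarrow> walk G us \<and> distinct us"

definition cycle :: "'v wdigraph \<Rightarrow> 'v list \<Rightarrow> bool" where
  "cycle G us \<longleftrightarrow> walk G us \<and> hd us = last us \<and> distinct (butlast us)"

definition interior :: "'v list \<Rightarrow> 'v set" where
  "interior us = set (butlast (tl us))"

definition branches_between :: "'v wdigraph \<Rightarrow> 'v set \<Rightarrow> 'v \<Rightarrow> 'v \<Rightarrow> 'v list set" where
  "branches_between G S i j =
     {us. (path G us \<or> cycle G us) \<and> hd us = i \<and> last us = j \<and> interior us \<inter> S = {}}"

definition branches :: "'v wdigraph \<Rightarrow> 'v set \<Rightarrow> 'v list set" where
  "branches G S = (\<Union>i\<in>S. \<Union>j\<in>S. branches_between G S i j)"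

definition st0 :: "'v wdigraph \<Rightarrow> 'v set set" where
  "st0 G = {S. S \<noteq> {} \<and> S \<subseteq> verts G \<and>
     (\<forall>us. cycle G us \<longrightarrow> set us \<inter> S \<noteq> {}) \<and>
     (\<forall>v \<in> verts G - S. weight G v v \<noteq> ratfun_var) \<and>
     (\<forall>v \<in> verts G. \<exists>\<beta> \<in> branches G S. v \<in> set \<beta>)}"

text \<open>Lists are indexed from 0, so the interior vertices of \<open>us\<close> are \<open>us ! k\<close> for
  \<open>1 \<le> k < length us - 1\<close>; the product is empty when the branch is a single edge.\<close>

definition branch_product :: "'v wdigraph \<Rightarrow> 'v list \<Rightarrow> ratfun" where
  "branch_product G us = weight G (us ! 0) (us ! 1) *
     (\<Prod>k = 1..<length us - 1.
        weight G (us ! k) (us ! Suc k) / (ratfun_var - weight G (us ! k) (us ! k)))"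

definition reduction :: "'v wdigraph \<Rightarrow> 'v set \<Rightarrow> 'v wdigraph" where
  "reduction G S = \<lparr>verts = S,
     weight = (\<lambda>i j. if i \<in> S \<and> j \<in> S
       then (\<Sum>\<beta> \<in> branches_between G S i j. branch_product G \<beta>) else 0)\<rparr>"

lemma finite_branches_between:
  assumes "finite (verts G)"
  shows "finite (branches_between G S i j)"
proof (rule finite_subset)
  show "branches_between G S i j \<subseteq>
      {us. set us \<subseteq> verts G \<and> length us \<le> Suc (card (verts G))}"
  proof
    fix us assume "us \<in> branches_between G S i j"
    then have w: "walk G us" and d: "distinct (butlast us)"
      by (auto simp: branches_between_def path_def cycle_def distinct_butlast)
    have sub: "set us \<subseteq> verts G"
    proof
      fix v assume "v \<in> set us"
      then obtain k where k: "k < length us" "v = us ! k" by (auto simp: in_set_conv_nth)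
      show "v \<in> verts G"
      proof (cases "Suc k < length us")
        case True
        then show ?thesis using w k by (auto simp: walk_def edges_def)
      next
        case False
        then have "Suc (k - 1) = k" "k < length us" using w k by (auto simp: walk_def)
        then show ?thesis using w k by (metis (no_types, lifting) case_prodD edges_def mem_Collect_eq walk_def)
      qed
    qed
    have "length (butlast us) \<le> card (verts G)"
      using d sub assms by (metis card_mono distinct_card in_set_butlastD subset_code(1))
    then show "us \<in> {us. set us \<subseteq> verts G \<and> length us \<le> Suc (card (verts G))}"
      using sub by auto
  qed
  show "finite {us. set us \<subseteq> verts G \<and> length us \<le> Suc (card (verts G))}"
    using assms by (rule finite_lists_length_le)
qed

definition gershgorin_region :: "ratfun mat \<Rightarrow> complex set" where
  "gershgorin_region B = (\<Union>i < dim_row B.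
     {z. (\<forall>j < dim_row B. ratfun_defined (B $$ (i, j)) z) \<and>
         cmod (z - ratfun_eval (B $$ (i, i)) z)
           \<le> (\<Sum>j \<in> {..<dim_row B} - {i}. cmod (ratfun_eval (B $$ (i, j)) z))})"

abbreviation const_mat :: "complex mat \<Rightarrow> ratfun mat" where
  "const_mat A \<equiv> map_mat ratfun_const A"

definition st0_mat :: "complex mat \<Rightarrow> nat set set" where
  "st0_mat A = st0 (mat_graph (const_mat A))"

definition reduced_mat :: "complex mat \<Rightarrow> nat set \<Rightarrow> ratfun mat" where
  "reduced_mat A S = adj_mat (reduction (mat_graph (const_mat A)) S)"

lemma gershgorin_region_const:
  assumes "A \<in> carrier_mat n n"
  shows "gershgorin_region (const_mat A) =
    (\<Union>i < n. {z. cmod (z - A $$ (i, i)) \<le> (\<Sum>j \<in> {..<n} - {i}. cmod (A $$ (i, j)))})"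
  using assms by (auto simp: gershgorin_region_def ratfun_defined_const ratfun_eval_const)

end

theory Submission
  imports Defs
begin

text \<open>
  Write \<open>T\<close> for the complement of \<open>S\<close>. The proof identifies the isospectral reduction with a Schur
  complement, but only through the recursion that the branch sums satisfy, without inverting
  a matrix. Every walk that ends in \<open>S\<close> and has no interior vertex in \<open>S\<close> is a path or a cycle, since
  every cycle meets \<open>S\<close>. So such walks may be extended freely at their first vertex, and
  splitting off the first edge gives, for every vertex \<open>k\<close> and every \<open>j \<in> S\<close>,
  \<open>t\<^sub>k\<^sub>j = a\<^sub>k\<^sub>j + (\<Sum>l\<in>T. a\<^sub>k\<^sub>l / (\<lambda> - a\<^sub>l\<^sub>l) * t\<^sub>l\<^sub>j)\<close>,
  where \<open>t\<^sub>k\<^sub>j\<close> is the sum of the branch products from \<open>k\<close> to \<open>j\<close>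
  (\<open>branch_sum_unfold\<close>). For \<open>k \<in> S\<close> these are the entries of the reduced matrix, and \<open>a\<^sub>l\<^sub>l = 0\<close> for
  \<open>l \<in> T\<close> because a loop is a cycle.

  Eigenvalues. Let \<open>A x = \<mu> x\<close> with \<open>\<mu> \<noteq> 0\<close> and \<open>x \<noteq> 0\<close>. By the recursion, the residual
  \<open>d\<^sub>k = \<mu> x\<^sub>k - (\<Sum>j\<in>S. t\<^sub>k\<^sub>j x\<^sub>j)\<close> satisfies
  \<open>d\<^sub>k = (\<Sum>l\<in>T. a\<^sub>k\<^sub>l d\<^sub>l / \<mu>)\<close> (\<open>reduced_residual\<close>). A vertex of \<open>T\<close> with nonzero residual
  would thus have a successor in \<open>T\<close> with nonzero residual, and so on for ever, which is impossible
  without cycles in \<open>T\<close> (\<open>no_infinite_walk_off_S\<close>). Hence \<open>d = 0\<close>: the restriction of \<open>x\<close> to \<open>S\<close> is a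
  vector on which the reduced matrix acts as \<open>\<mu>\<close>, and it is nonzero because it
  determines \<open>x\<close>. The Gershgorin argument for the reduced matrix finishes this part.

  Inclusion of the regions. A point outside the region of \<open>A\<close> is one where \<open>z I - A\<close> is strictly diagonally
  dominant, and dominance passes to the Schur complement
  (\<open>schur_complement_dominant\<close>), so that the point is outside the region of the reduced matrix as
  well. Strict dominance in a row of \<open>T\<close>, whose diagonal entry is \<open>z\<close>, also rules out \<open>z = 0\<close>,
  the only possible pole of the reduced matrix.
\<close>

section \<open>Evaluation of rational functions\<close>

lemma ratfun_value_add:
  assumes "ratfun_value f z a" "ratfun_value g z b"
  shows "ratfun_value (f + g) z (a + b)"
proof -
  obtain p q where f: "f = Fract p q" "poly q z \<noteq> 0" "a = poly p z / poly q z"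
    using assms(1) by (auto simp: ratfun_value_def)
  obtain r s where g: "g = Fract r s" "poly s z \<noteq> 0" "b = poly r z / poly s z"
    using assms(2) by (auto simp: ratfun_value_def)
  have "q \<noteq> 0" "s \<noteq> 0" using f g by auto
  then have "f + g = Fract (p * s + r * q) (q * s)" using f g by simp
  moreover have "poly (q * s) z \<noteq> 0" using f g by simp
  moreover have "a + b = poly (p * s + r * q) z / poly (q * s) z"
    unfolding f(3) g(3) using f(2) g(2) by (simp add: add_frac_eq)
  ultimately show ?thesis unfolding ratfun_value_def by blast
qed

lemma ratfun_value_mult:
  assumes "ratfun_value f z a" "ratfun_value g z b"
  shows "ratfun_value (f * g) z (a * b)"
proof -
  obtain p q where f: "f = Fract p q" "poly q z \<noteq> 0" "a = poly p z / poly q z"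
    using assms(1) by (auto simp: ratfun_value_def)
  obtain r s where g: "g = Fract r s" "poly s z \<noteq> 0" "b = poly r z / poly s z"
    using assms(2) by (auto simp: ratfun_value_def)
  have "f * g = Fract (p * r) (q * s)" using f g by simp
  moreover have "poly (q * s) z \<noteq> 0" using f g by simp
  moreover have "a * b = poly (p * r) z / poly (q * s) z"
    using f g by simp
  ultimately show ?thesis unfolding ratfun_value_def by blast
qed

lemma ratfun_value_inverse:
  assumes "ratfun_value f z a" "a \<noteq> 0"
  shows "ratfun_value (inverse f) z (inverse a)"
proof -
  obtain p q where f: "f = Fract p q" "poly q z \<noteq> 0" "a = poly p z / poly q z"
    using assms(1) by (auto simp: ratfun_value_def)
  have "inverse f = Fract q p" "poly p z \<noteq> 0" "inverse a = poly q z / poly p z"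
    using f assms(2) by auto
  then show ?thesis unfolding ratfun_value_def by blast
qed

lemma ratfun_value_const: "ratfun_value (ratfun_const c) z c"
  unfolding ratfun_value_def to_fract_def
  by (rule exI[of _ "[:c:]"], rule exI[of _ 1]) simp

lemma ratfun_value_var: "ratfun_value ratfun_var z z"
  unfolding ratfun_value_def to_fract_def
  by (rule exI[of _ "[:0, 1:]"], rule exI[of _ 1]) simp

lemma ratfun_value_zero: "ratfun_value 0 z 0"
  using ratfun_value_const[of 0 z] by simp

lemma ratfun_value_one: "ratfun_value 1 z 1"
  using ratfun_value_const[of 1 z] by (simp flip: one_pCons)

lemma ratfun_value_sum:
  "(\<And>x. x \<in> X \<Longrightarrow> ratfun_value (f x) z (g x)) \<Longrightarrow> ratfun_value (sum f X) z (sum g X)"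
  by (induction X rule: infinite_finite_induct) (auto simp: ratfun_value_zero intro: ratfun_value_add)

lemma ratfun_value_prod:
  "(\<And>x. x \<in> X \<Longrightarrow> ratfun_value (f x) z (g x)) \<Longrightarrow> ratfun_value (prod f X) z (prod g X)"
  by (induction X rule: infinite_finite_induct) (auto simp: ratfun_value_one intro: ratfun_value_mult)

lemma ratfun_value_eval: "ratfun_defined f z \<Longrightarrow> ratfun_value f z (ratfun_eval f z)"
  unfolding ratfun_defined_def by (auto dest: ratfun_eval_eq)

section \<open>Branches when every cycle meets the structural set\<close>

lemma walk_iff_successively:
  "walk G us \<longleftrightarrow> 2 \<le> length us \<and> successively (\<lambda>u v. (u, v) \<in> edges G) us"
  unfolding walk_def successively_conv_nth by auto

text \<open>The repetition is chosen innermost, so that in a walk it cuts out a cycle and not merely a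
  closed walk.\<close>

lemma not_distinct_innermost_repetition:
  "\<not> distinct xs \<Longrightarrow> \<exists>ys y zs ws. xs = ys @ (y # zs @ [y]) @ ws \<and> distinct (y # zs)"
proof (induction xs)
  case (Cons x xs)
  show ?case
  proof (cases "distinct xs")
    case True
    with Cons.prems have "x \<in> set xs" by simp
    then obtain zs ws where zs: "xs = zs @ x # ws" "x \<notin> set zs" by (meson split_list_first)
    then have "x # xs = [] @ (x # zs @ [x]) @ ws" "distinct (x # zs)" using True by auto
    then show ?thesis by blast
  next
    case False
    then obtain ys y zs ws where "xs = ys @ (y # zs @ [y]) @ ws" "distinct (y # zs)"
      using Cons.IH by blast
    then have "x # xs = (x # ys) @ (y # zs @ [y]) @ ws" "distinct (y # zs)" by auto
    then show ?thesis by blast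
  qed
qed simp

lemma walk_off_S_distinct:
  assumes cyc: "\<forall>us. cycle G us \<longrightarrow> set us \<inter> S \<noteq> {}"
    and suc: "successively (\<lambda>u v. (u, v) \<in> edges G) xs" and off: "set xs \<inter> S = {}"
  shows "distinct xs"
proof (rule ccontr)
  assume "\<not> distinct xs"
  then obtain ys y zs ws where xs: "xs = ys @ (y # zs @ [y]) @ ws" and d: "distinct (y # zs)"
    using not_distinct_innermost_repetition by blast
  let ?c = "y # zs @ [y]"
  have "successively (\<lambda>u v. (u, v) \<in> edges G) ?c"
    using suc unfolding xs by (simp only: successively_append_iff)
  moreover have "butlast ?c = y # zs" "last ?c = y" by (simp_all add: butlast_append)
  ultimately have "cycle G ?c"
    using d unfolding cycle_def walk_iff_successively by simp
  then have "set ?c \<inter> S \<noteq> {}" using cyc by blast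
  then show False using off unfolding xs by auto
qed

text \<open>Distinctness comes for free: a repeated vertex would produce a cycle that avoids \<open>S\<close>. What
  remains is a local condition on the list, so that a first vertex can be added or removed.
  The start \<open>k\<close> may lie outside \<open>S\<close>, because removing the first vertex of a branch leads there.\<close>

lemma branches_between_eq_walks:
  assumes cyc: "\<forall>us. cycle G us \<longrightarrow> set us \<inter> S \<noteq> {}" and j: "j \<in> S"
  shows "branches_between G S k j =
    {us. walk G us \<and> hd us = k \<and> last us = j \<and> interior us \<inter> S = {}}"
proof -
  have "path G us \<or> cycle G us" if w: "walk G us" and l: "last us \<in> S" and i: "interior us \<inter> S = {}" for us
  proof -
    have len: "2 \<le> length us" and suc: "successively (\<lambda>u v. (u, v) \<in> edges G) us"
      using w by (simp_all add: walk_iff_successively)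
    obtain a vs where "us = a # vs" "vs \<noteq> []" using len by (cases us) fastforce+
    then obtain ms b where us: "us = a # ms @ [b]" by (metis append_butlast_last_id)
    have int: "interior us = set ms" and b: "b \<in> S" using l unfolding us interior_def by auto
    have "successively (\<lambda>u v. (u, v) \<in> edges G) ((a # ms) @ [b])" using suc unfolding us by simp
    then have suca: "successively (\<lambda>u v. (u, v) \<in> edges G) (a # ms)"
      unfolding successively_append_iff by blast
    then have sucm: "successively (\<lambda>u v. (u, v) \<in> edges G) ms"
      by (auto simp: successively_Cons)
    have ms: "set ms \<inter> S = {}" using i int by simp
    have dm: "distinct ms" using walk_off_S_distinct[OF cyc sucm ms] .
    have da: "distinct (a # ms)"
    proof (cases "a \<in> S")
      case True
      then show ?thesis using dm ms by auto
    next
      case False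
      then show ?thesis using walk_off_S_distinct[OF cyc suca] ms by auto
    qed
    have "butlast us = a # ms" unfolding us by (simp add: butlast_append)
    show ?thesis
    proof (cases "a = b")
      case True
      then have "cycle G us" using w da \<open>butlast us = a # ms\<close> unfolding cycle_def us by simp
      then show ?thesis ..
    next
      case False
      then have "distinct us" using da b ms unfolding us by auto
      then show ?thesis using w by (simp add: path_def)
    qed
  qed
  then show ?thesis unfolding branches_between_def using j by (auto simp: path_def cycle_def)
qed

lemma branches_between_unfold:
  assumes cyc: "\<forall>us. cycle G us \<longrightarrow> set us \<inter> S \<noteq> {}" and j: "j \<in> S"
  shows "branches_between G S k j =
    (if (k, j) \<in> edges G then {[k, j]} else {}) \<union>
    (\<Union>l \<in> {l \<in> verts G - S. (k, l) \<in> edges G}. (#) k ` branches_between G S l j)"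
    (is "?L = ?R")
proof (intro equalityI subsetI)
  fix us assume "us \<in> ?L"
  then have w: "walk G us" and h: "hd us = k" "last us = j" "interior us \<inter> S = {}"
    unfolding branches_between_eq_walks[OF cyc j] by auto
  then obtain l vs where us: "us = k # l # vs"
    unfolding walk_def by (cases us; cases "tl us") auto
  show "us \<in> ?R"
  proof (cases "vs = []")
    case True
    then show ?thesis using w h us by (auto simp: walk_iff_successively)
  next
    case False
    have e: "(k, l) \<in> edges G" using w us by (auto simp: walk_iff_successively)
    have "l \<notin> S" using h(3) False unfolding us interior_def by auto
    moreover have "l \<in> verts G" using e by (auto simp: edges_def)
    moreover have "walk G (l # vs)" using w us False
      by (auto simp: walk_iff_successively Suc_le_eq)
    moreover have "interior (l # vs) \<inter> S = {}"
      using h(3) False unfolding us interior_def by auto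
    ultimately have "l # vs \<in> branches_between G S l j"
      using h(2) us False unfolding branches_between_eq_walks[OF cyc j] by auto
    then show ?thesis using e \<open>l \<notin> S\<close> \<open>l \<in> verts G\<close> us by auto
  qed
next
  fix us assume "us \<in> ?R"
  then consider "(k, j) \<in> edges G" "us = [k, j]"
    | l vs where "l \<notin> S" "(k, l) \<in> edges G" "us = k # vs" "vs \<in> branches_between G S l j"
    by (auto split: if_splits)
  then show "us \<in> ?L"
  proof cases
    case 1
    then show ?thesis unfolding branches_between_eq_walks[OF cyc j]
      by (auto simp: walk_iff_successively interior_def)
  next
    case 2
    then have vs: "walk G vs" "hd vs = l" "last vs = j" "interior vs \<inter> S = {}"
      unfolding branches_between_eq_walks[OF cyc j] by auto
    then obtain m ws where "vs = l # m # ws"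
      unfolding walk_def by (cases vs; cases "tl vs") auto
    then show ?thesis using vs 2 unfolding branches_between_eq_walks[OF cyc j]
      by (auto simp: walk_iff_successively interior_def)
  qed
qed

text \<open>For \<open>k, j \<in> S\<close> this is the edge weight of the reduction; the recursion also needs it for
  \<open>k\<close> outside \<open>S\<close>.\<close>

definition branch_sum :: "'v wdigraph \<Rightarrow> 'v set \<Rightarrow> 'v \<Rightarrow> 'v \<Rightarrow> ratfun" where
  "branch_sum G S k j = (\<Sum>\<beta> \<in> branches_between G S k j. branch_product G \<beta>)"

lemma branch_product_Cons:
  assumes "2 \<le> length us" "hd us = l"
  shows "branch_product G (k # us) =
    weight G k l / (ratfun_var - weight G l l) * branch_product G us"
proof -
  obtain m ws where us: "us = l # m # ws" using assms by (cases us; cases "tl us") auto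
  define g where "g us i = weight G (us ! i) (us ! Suc i) /
    (ratfun_var - weight G (us ! i) (us ! i))" for us i
  have "prod (g (k # us)) {1..<Suc (length us - 1)} =
      g (k # us) 1 * prod (g (k # us)) {Suc 1..<Suc (length us - 1)}"
    by (rule prod.atLeast_Suc_lessThan) (use assms in simp)
  also have "prod (g (k # us)) {Suc 1..<Suc (length us - 1)} = prod (g us) {1..<length us - 1}"
    unfolding prod.shift_bounds_Suc_ivl by (simp add: g_def)
  finally show ?thesis
    unfolding branch_product_def g_def[symmetric] by (simp add: us g_def)
qed

text \<open>The sums over \<open>(#) k ` branches_between G S l j\<close> factor because prefixing \<open>k\<close> turns
  \<open>l\<close> from an end point into an interior vertex, which adds one factor to every branch product.
  For \<open>k\<close> outside \<open>S\<close> the equations form a linear system for the unknowns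
  \<open>branch_sum G S l j\<close>; its solution inserted into the equation of a \<open>k \<in> S\<close> is the Schur
  complement.\<close>

lemma branch_sum_unfold:
  assumes fin: "finite (verts G)"
    and cyc: "\<forall>us. cycle G us \<longrightarrow> set us \<inter> S \<noteq> {}"
    and k: "k \<in> verts G" and j: "j \<in> S" "j \<in> verts G"
  shows "branch_sum G S k j = weight G k j +
    (\<Sum>l \<in> verts G - S. weight G k l / (ratfun_var - weight G l l) * branch_sum G S l j)"
proof -
  let ?N = "{l \<in> verts G - S. (k, l) \<in> edges G}"
  let ?E = "if (k, j) \<in> edges G then {[k, j]} else {}"
  let ?F = "\<lambda>l. (#) k ` branches_between G S l j"
  have finB: "finite (branches_between G S l j)" for l by (rule finite_branches_between[OF fin])
  have B: "walk G us" "hd us = l" "us \<noteq> []" if "us \<in> branches_between G S l j" for us l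
    using that unfolding branches_between_eq_walks[OF cyc j(1)] by (auto simp: walk_def)
  have "branch_sum G S k j = sum (branch_product G) ?E + sum (branch_product G) (\<Union>l\<in>?N. ?F l)"
    unfolding branch_sum_def branches_between_unfold[OF cyc j(1), of k]
  proof (rule sum.union_disjoint)
    show "finite (\<Union>l\<in>?N. ?F l)" using fin finB by auto
    show "?E \<inter> (\<Union>l\<in>?N. ?F l) = {}" using B by (fastforce simp: walk_def split: if_splits)
  qed auto
  also have "sum (branch_product G) ?E = weight G k j"
    using k j by (auto simp: branch_product_def edges_def)
  also have "sum (branch_product G) (\<Union>l\<in>?N. ?F l) = (\<Sum>l\<in>?N. sum (branch_product G) (?F l))"
  proof (rule sum.UNION_disjoint)
    show "\<forall>l\<in>?N. \<forall>m\<in>?N. l \<noteq> m \<longrightarrow> ?F l \<inter> ?F m = {}" using B(2) by blast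
  qed (use fin finB in auto)
  also have "\<dots> = (\<Sum>l\<in>?N. weight G k l / (ratfun_var - weight G l l) * branch_sum G S l j)"
  proof (rule sum.cong[OF refl])
    fix l
    have "sum (branch_product G) (?F l) = (\<Sum>us\<in>branches_between G S l j. branch_product G (k # us))"
      by (subst sum.reindex) auto
    also have "\<dots> = (\<Sum>us\<in>branches_between G S l j.
        weight G k l / (ratfun_var - weight G l l) * branch_product G us)"
      by (rule sum.cong[OF refl], rule branch_product_Cons) (use B in \<open>auto simp: walk_def\<close>)
    finally show "sum (branch_product G) (?F l) =
        weight G k l / (ratfun_var - weight G l l) * branch_sum G S l j"
      by (simp add: branch_sum_def sum_distrib_left)
  qed
  also have "\<dots> = (\<Sum>l\<in>verts G - S. weight G k l / (ratfun_var - weight G l l) * branch_sum G S l j)"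
    by (rule sum.mono_neutral_left) (use fin k in \<open>auto simp: edges_def\<close>)
  finally show ?thesis .
qed

lemma walk_subset_verts:
  assumes "walk G us" "v \<in> set us"
  shows "v \<in> verts G"
proof -
  obtain k where k: "k < length us" "v = us ! k" using assms(2) by (auto simp: in_set_conv_nth)
  show ?thesis
  proof (cases k)
    case 0
    then have "(us ! k, us ! Suc k) \<in> edges G" using assms(1) by (auto simp: walk_def)
    then show ?thesis using k by (auto simp: edges_def)
  next
    case (Suc m)
    then have "(us ! m, us ! Suc m) \<in> edges G" using assms(1) k by (auto simp: walk_def)
    then show ?thesis using k Suc by (auto simp: edges_def)
  qed
qed

text \<open>The only denominators are those of the interior vertices, which lie outside \<open>S\<close>.\<close>

lemma branch_product_defined:
  assumes w: "\<And>u v. u \<in> verts G \<Longrightarrow> v \<in> verts G \<Longrightarrow> ratfun_value (weight G u v) z (a u v)"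
    and ne: "\<And>l. l \<in> verts G - S \<Longrightarrow> z \<noteq> a l l"
    and us: "us \<in> branches_between G S k j"
  shows "ratfun_defined (branch_product G us) z"
proof -
  have wk: "walk G us" and int: "interior us \<inter> S = {}"
    using us by (auto simp: branches_between_def path_def cycle_def)
  then have len: "2 \<le> length us" by (simp add: walk_def)
  have V: "us ! i \<in> verts G" if "i < length us" for i
    using walk_subset_verts[OF wk] that by simp
  have off: "us ! i \<notin> S" if "1 \<le> i" "i < length us - 1" for i
  proof -
    have "butlast (tl us) ! (i - 1) = us ! i" "i - 1 < length (butlast (tl us))"
      using that by (auto simp: nth_butlast nth_tl)
    then have "us ! i \<in> interior us" unfolding interior_def by (metis nth_mem)
    then show ?thesis using int by blast
  qed
  have "ratfun_value (branch_product G us) z (a (us ! 0) (us ! 1) *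
      (\<Prod>i = 1..<length us - 1. a (us ! i) (us ! Suc i) * inverse (z + - 1 * a (us ! i) (us ! i))))"
    unfolding branch_product_def divide_inverse
  proof (intro ratfun_value_mult ratfun_value_prod w ratfun_value_inverse V)
    fix i assume i: "i \<in> {1..<length us - 1}"
    have "ratfun_value (ratfun_var + ratfun_const (- 1) * weight G (us ! i) (us ! i)) z
        (z + - 1 * a (us ! i) (us ! i))"
      by (intro ratfun_value_add ratfun_value_mult ratfun_value_var ratfun_value_const w V)
        (use i in auto)
    moreover have "ratfun_const (- 1) = - 1"
      by (metis minus_pCons minus_zero one_pCons to_fract_1 to_fract_uminus)
    ultimately show "ratfun_value (ratfun_var - weight G (us ! i) (us ! i)) z
        (z + - 1 * a (us ! i) (us ! i))" by simp
    show "z + - 1 * a (us ! i) (us ! i) \<noteq> 0"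
      using ne[of "us ! i"] off[of i] V[of i] i by auto
  qed (use len in auto)
  then show ?thesis by (auto simp: ratfun_defined_def)
qed

text \<open>This replaces the nilpotency of the block of the matrix outside \<open>S\<close>: with \<open>P\<close> the support of a
  vector in the kernel of \<open>z I\<close> minus that block, it shows that the vector vanishes. Following the
  successors gives walks of any length, yet walks off \<open>S\<close> have no repeated vertex.\<close>

lemma no_infinite_walk_off_S:
  assumes fin: "finite (verts G)"
    and cyc: "\<forall>us. cycle G us \<longrightarrow> set us \<inter> S \<noteq> {}"
    and step: "\<And>k. k \<in> verts G - S \<Longrightarrow> P k \<Longrightarrow> \<exists>l \<in> verts G - S. P l \<and> (k, l) \<in> edges G"
    and k: "k \<in> verts G - S"
  shows "\<not> P k"
proof
  assume "P k"
  let ?W = "\<lambda>k m xs. length xs = Suc m \<and> hd xs = k \<and> set xs \<subseteq> verts G - S \<and>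
    successively (\<lambda>u v. (u, v) \<in> edges G) xs"
  have "\<exists>xs. ?W k m xs" if "k \<in> verts G - S" "P k" for m k
    using that
  proof (induction m arbitrary: k)
    case 0
    then have "?W k 0 [k]" by auto
    then show ?case ..
  next
    case (Suc m)
    then obtain l where l: "l \<in> verts G - S" "P l" "(k, l) \<in> edges G" using step by blast
    then obtain xs where "?W l m xs" using Suc.IH by blast
    then have "?W k (Suc m) (k # xs)" using l Suc.prems by (auto simp: successively_Cons)
    then show ?case ..
  qed
  then obtain xs where xs: "?W k (card (verts G - S)) xs" using \<open>P k\<close> k by blast
  then have "distinct xs" by (intro walk_off_S_distinct[OF cyc]) auto
  then have "length xs = card (set xs)" by (simp add: distinct_card)
  also have "\<dots> \<le> card (verts G - S)" using xs fin by (intro card_mono) auto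
  finally show False using xs by simp
qed

section \<open>Diagonal dominance and the Schur complement\<close>

text \<open>The row is one at which \<open>x\<close> has an entry of largest modulus.\<close>

lemma gershgorin_disc:
  fixes b :: "'i \<Rightarrow> 'i \<Rightarrow> complex" and x :: "'i \<Rightarrow> complex"
  assumes fin: "finite I" and ne: "i0 \<in> I" "x i0 \<noteq> 0"
    and ev: "\<And>i. i \<in> I \<Longrightarrow> (\<Sum>j\<in>I. b i j * x j) = z * x i"
  shows "\<exists>i\<in>I. cmod (z - b i i) \<le> (\<Sum>j\<in>I - {i}. cmod (b i j))"
proof -
  obtain i where i: "i \<in> I" and max: "\<And>j. j \<in> I \<Longrightarrow> cmod (x j) \<le> cmod (x i)"
    using obtains_MAX[OF fin, of "\<lambda>i. cmod (x i)"] ne(1) Max_ge[OF finite_imageI[OF fin]]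
    by (metis empty_iff imageI)
  have pos: "cmod (x i) > 0" using max[OF ne(1)] ne(2) by (smt (verit) zero_less_norm_iff)
  have "(z - b i i) * x i = (\<Sum>j\<in>I - {i}. b i j * x j)"
    using ev[OF i] sum.remove[OF fin i, of "\<lambda>j. b i j * x j"] by (simp add: algebra_simps)
  then have "cmod (z - b i i) * cmod (x i) = cmod (\<Sum>j\<in>I - {i}. b i j * x j)"
    by (metis norm_mult)
  also have "\<dots> \<le> (\<Sum>j\<in>I - {i}. cmod (b i j) * cmod (x i))"
    by (rule sum_norm_le) (auto simp: norm_mult intro: mult_left_mono max)
  also have "\<dots> = (\<Sum>j\<in>I - {i}. cmod (b i j)) * cmod (x i)" by (simp add: sum_distrib_right)
  finally show ?thesis using pos i by auto
qed

text \<open>The equation also covers rows \<open>k \<in> S\<close>. Once the residuals on \<open>T\<close> are known to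
  vanish, the right-hand side is \<open>0\<close> there too, which is the eigenvalue equation of the reduced matrix.\<close>

lemma reduced_residual:
  fixes a t :: "'i \<Rightarrow> 'i \<Rightarrow> complex"
  assumes fin: "finite S" "finite T" and disj: "S \<inter> T = {}" and z: "z \<noteq> 0"
    and rec: "\<And>j. j \<in> S \<Longrightarrow> t k j = a k j + (\<Sum>l\<in>T. a k l / z * t l j)"
    and ev: "(\<Sum>m\<in>S \<union> T. a k m * x m) = z * x k"
  shows "z * x k - (\<Sum>j\<in>S. t k j * x j) =
    (\<Sum>l\<in>T. a k l / z * (z * x l - (\<Sum>j\<in>S. t l j * x j)))"
proof -
  have "(\<Sum>j\<in>S. t k j * x j) = (\<Sum>j\<in>S. a k j * x j + (\<Sum>l\<in>T. a k l / z * (t l j * x j)))"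
    by (rule sum.cong[OF refl]) (simp add: rec sum_distrib_left sum_distrib_right algebra_simps)
  also have "\<dots> = (\<Sum>j\<in>S. a k j * x j) + (\<Sum>l\<in>T. a k l / z * (\<Sum>j\<in>S. t l j * x j))"
    unfolding sum.distrib sum_distrib_left by (subst sum.swap) simp
  finally have t: "(\<Sum>j\<in>S. t k j * x j) =
    (\<Sum>j\<in>S. a k j * x j) + (\<Sum>l\<in>T. a k l / z * (\<Sum>j\<in>S. t l j * x j))" .
  have "z * x k = (\<Sum>j\<in>S. a k j * x j) + (\<Sum>l\<in>T. a k l * x l)"
    using ev unfolding sum.union_disjoint[OF fin disj] by (rule sym)
  then show ?thesis using z unfolding t by (simp add: algebra_simps sum_subtractf)
qed

text \<open>For \<open>l \<in> T\<close> the row sum \<open>M l\<close> of \<open>t\<close> is at most \<open>\<bar>z\<bar>\<close>, by looking at the largest one.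
  So replacing an entry \<open>a\<^sub>i\<^sub>l\<close> of row \<open>i \<in> S\<close> by the contributions
  \<open>a\<^sub>i\<^sub>l t\<^sub>l\<^sub>j / z\<close>, one for each \<open>j \<in> S\<close>, does not increase the total modulus. Hence
  the shift of the centre of the disc of row \<open>i\<close> plus its new radius is at most its old radius.\<close>

lemma schur_complement_dominant:
  fixes a t :: "'i \<Rightarrow> 'i \<Rightarrow> complex"
  assumes fin: "finite S" "finite T" and disj: "S \<inter> T = {}"
    and rec: "\<And>k j. k \<in> S \<union> T \<Longrightarrow> j \<in> S \<Longrightarrow> t k j = a k j + (\<Sum>l\<in>T. a k l / z * t l j)"
    and loop: "\<And>l. l \<in> T \<Longrightarrow> a l l = 0"
    and dom: "\<And>k. k \<in> S \<union> T \<Longrightarrow> (\<Sum>m\<in>S \<union> T - {k}. cmod (a k m)) < cmod (z - a k k)"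
    and i: "i \<in> S"
  shows "(\<Sum>j\<in>S - {i}. cmod (t i j)) < cmod (z - t i i)"
proof -
  define M where "M l = (\<Sum>j\<in>S. cmod (t l j))" for l
  (* Subtracting a k k from the diagonal entry treats both uses at once: for k in T there is no
     diagonal entry among the columns S, and for k in S it leaves the off-diagonal row sum plus
     the perturbation of the centre of the disc. *)
  have rowsum: "(\<Sum>j\<in>S. cmod (t k j - (if j = k then a k k else 0))) \<le>
      (\<Sum>j\<in>S - {k}. cmod (a k j)) + (\<Sum>l\<in>T. cmod (a k l) / cmod z * M l)"
    if k: "k \<in> S \<union> T" for k
  proof -
    have "(\<Sum>j\<in>S. cmod (t k j - (if j = k then a k k else 0))) \<le>
        (\<Sum>j\<in>S. (if j = k then 0 else cmod (a k j)) + (\<Sum>l\<in>T. cmod (a k l) / cmod z * cmod (t l j)))"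
    proof (rule sum_mono)
      fix j assume j: "j \<in> S"
      have "cmod (\<Sum>l\<in>T. a k l / z * t l j) \<le> (\<Sum>l\<in>T. cmod (a k l) / cmod z * cmod (t l j))"
        by (rule sum_norm_le) (simp add: norm_mult norm_divide)
      then show "cmod (t k j - (if j = k then a k k else 0)) \<le> (if j = k then 0 else cmod (a k j)) +
          (\<Sum>l\<in>T. cmod (a k l) / cmod z * cmod (t l j))"
        using rec[OF k j] by (auto intro: order_trans[OF norm_triangle_ineq])
    qed
    also have "\<dots> = (\<Sum>j\<in>S - {k}. cmod (a k j)) + (\<Sum>l\<in>T. cmod (a k l) / cmod z * M l)"
    proof -
      have "(\<Sum>j\<in>S. if j = k then 0 else cmod (a k j)) = (\<Sum>j\<in>S - {k}. cmod (a k j))"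
        by (rule sum.mono_neutral_cong_right) (use fin in auto)
      then show ?thesis unfolding sum.distrib M_def sum_distrib_left by (subst sum.swap) simp
    qed
    finally show ?thesis .
  qed
  have T_bound: "M l \<le> cmod z" if l: "l \<in> T" for l
  proof (rule ccontr)
    assume gt: "\<not> M l \<le> cmod z"
    obtain m where m: "m \<in> T" and max: "\<And>l. l \<in> T \<Longrightarrow> M l \<le> M m"
      using obtains_MAX[OF fin(2), of M] l Max_ge[OF finite_imageI[OF fin(2)]]
      by (metis empty_iff imageI)
    (* If q > 1, every entry of row m contributes at most q times its modulus to M m, whether its
       column is in S or in T; but by dominance these moduli add up to less than M m / q. *)
    define q where "q = M m / cmod z"
    have d: "(\<Sum>j\<in>S \<union> T - {m}. cmod (a m j)) < cmod z" using dom[of m] loop m by simp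
    then have z: "cmod z > 0" by (smt (verit) sum_nonneg norm_ge_zero)
    have q: "q > 1" using gt max[OF l] z by (simp add: q_def)
    have mS: "m \<notin> S" using m disj by auto
    have "M m = (\<Sum>j\<in>S. cmod (t m j - (if j = m then a m m else 0)))"
      unfolding M_def by (rule sum.cong) (use mS in auto)
    also have "\<dots> \<le> (\<Sum>j\<in>S - {m}. cmod (a m j)) + (\<Sum>l\<in>T. cmod (a m l) / cmod z * M l)"
      using rowsum[of m] m by auto
    also have "(\<Sum>l\<in>T. cmod (a m l) / cmod z * M l) \<le> (\<Sum>l\<in>T. cmod (a m l) * q)"
    proof (rule sum_mono)
      fix l assume "l \<in> T"
      have "cmod (a m l) / cmod z * M l \<le> cmod (a m l) / cmod z * M m"
        by (rule mult_left_mono[OF max[OF \<open>l \<in> T\<close>]]) simp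
      then show "cmod (a m l) / cmod z * M l \<le> cmod (a m l) * q" by (simp add: q_def)
    qed
    also have "(\<Sum>j\<in>S - {m}. cmod (a m j)) \<le> (\<Sum>j\<in>S. cmod (a m j) * q)"
      using mS q by (auto intro!: sum_mono simp: mult_le_cancel_left1)
    also have "(\<Sum>j\<in>S. cmod (a m j) * q) + (\<Sum>l\<in>T. cmod (a m l) * q) =
        (\<Sum>j\<in>S \<union> T. cmod (a m j)) * q"
      by (simp add: sum.union_disjoint[OF fin disj] sum_distrib_right distrib_right)
    also have "(\<Sum>j\<in>S \<union> T. cmod (a m j)) = (\<Sum>j\<in>S \<union> T - {m}. cmod (a m j))"
      by (rule sum.mono_neutral_right) (use fin loop m in auto)
    also have "\<dots> * q < cmod z * q" using d q by simp
    also have "\<dots> = M m" using z by (simp add: q_def)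
    finally show False by simp
  qed
  have "cmod (t i i - a i i) + (\<Sum>j\<in>S - {i}. cmod (t i j)) =
      (\<Sum>j\<in>S. cmod (t i j - (if j = i then a i i else 0)))"
    by (simp add: sum.remove[OF fin(1) i])
  also have "\<dots> \<le> (\<Sum>j\<in>S - {i}. cmod (a i j)) + (\<Sum>l\<in>T. cmod (a i l) / cmod z * M l)"
    using rowsum[of i] i by auto
  also have "(\<Sum>l\<in>T. cmod (a i l) / cmod z * M l) \<le> (\<Sum>l\<in>T. cmod (a i l))"
  proof (rule sum_mono)
    fix l assume l: "l \<in> T"
    have "M l / cmod z \<le> 1" using T_bound[OF l] by (simp add: divide_le_eq_1)
    then show "cmod (a i l) / cmod z * M l \<le> cmod (a i l)"
      using mult_left_mono[of "M l / cmod z" 1 "cmod (a i l)"] by simp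
  qed
  also have "(\<Sum>j\<in>S - {i}. cmod (a i j)) + (\<Sum>l\<in>T. cmod (a i l)) =
      (\<Sum>m\<in>S \<union> T - {i}. cmod (a i m))"
  proof -
    have "S \<union> T - {i} = (S - {i}) \<union> T" using i disj by auto
    moreover have "(S - {i}) \<inter> T = {}" using disj by auto
    ultimately show ?thesis using sum.union_disjoint[of "S - {i}" T "\<lambda>m. cmod (a i m)"] fin by simp
  qed
  also have "\<dots> < cmod (z - a i i)" using dom i by simp
  also have "\<dots> \<le> cmod (z - t i i) + cmod (t i i - a i i)"
    using norm_triangle_ineq[of "z - t i i" "t i i - a i i"] by simp
  finally show ?thesis by simp
qed

section \<open>The regions of a matrix and of its reduction\<close>

text \<open>The region does not depend on the order in which the vertices index the matrix.\<close>

lemma gershgorin_region_adj_mat: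
  assumes fin: "finite (verts G)"
  shows "z \<in> gershgorin_region (adj_mat G) \<longleftrightarrow>
    (\<exists>i \<in> verts G. (\<forall>j \<in> verts G. ratfun_defined (weight G i j) z) \<and>
      cmod (z - ratfun_eval (weight G i i) z)
        \<le> (\<Sum>j \<in> verts G - {i}. cmod (ratfun_eval (weight G i j) z)))"
proof -
  define vs where "vs = sorted_list_of_set (verts G)"
  define N where "N = card (verts G)"
  have bij: "bij_betw ((!) vs) {..<N} (verts G)"
    unfolding vs_def N_def by (rule bij_betw_nth) (use fin in auto)
  have V: "verts G = (!) vs ` {..<N}" using bij by (simp add: bij_betw_def)
  have adj: "adj_mat G = mat N N (\<lambda>(i, j). weight G (vs ! i) (vs ! j))"
    by (simp add: adj_mat_def vs_def N_def Let_def)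
  have sums: "(\<Sum>j \<in> verts G - {vs ! i}. f j) = (\<Sum>j \<in> {..<N} - {i}. f (vs ! j))"
    if "i < N" for f :: "'a \<Rightarrow> real" and i
  proof (rule sum.reindex_bij_betw[symmetric])
    show "bij_betw ((!) vs) ({..<N} - {i}) (verts G - {vs ! i})"
      using bij that by (intro bij_betw_DiffI) (auto simp: V)
  qed
  show ?thesis
    unfolding gershgorin_region_def adj
    by (simp add: V[symmetric]) (unfold V, auto simp: sums[unfolded V] Ball_def)
qed

theorem theorem4p12:
  fixes A :: "complex mat" and n :: nat and S :: "nat set"
  assumes "A \<in> carrier_mat n n"
    and "S \<in> st0_mat A"
  shows "{\<mu>. eigenvalue A \<mu> \<and> \<mu> \<noteq> 0} \<subseteq> gershgorin_region (reduced_mat A S)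
    \<and> gershgorin_region (reduced_mat A S) \<subseteq> gershgorin_region (const_mat A)"
proof -
  define G where "G = mat_graph (const_mat A)"
  define T where "T = {0..<n} - S"
  define a where "a i j = A $$ (i, j)" for i j
  define t where "t z i j = ratfun_eval (branch_sum G S i j) z" for z i j
  have V: "verts G = {0..<n}" using assms(1) by (simp add: G_def mat_graph_def)
  have finV: "finite (verts G)" by (simp add: V)
  have W: "weight G i j = ratfun_const (a i j)" if "i \<in> verts G" "j \<in> verts G" for i j
    using that assms(1) by (simp add: V a_def) (simp add: G_def mat_graph_def)
  have S: "S \<noteq> {}" "S \<subseteq> {0..<n}" and cyc: "\<forall>us. cycle G us \<longrightarrow> set us \<inter> S \<noteq> {}"
    using assms(2) unfolding st0_mat_def st0_def G_def[symmetric] V by auto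
  have fin: "finite S" "finite T" and disj: "S \<inter> T = {}" and un: "S \<union> T = {0..<n}"
    using S finite_subset by (auto simp: T_def)
  have loop: "a l l = 0" if "l \<in> T" for l
  proof (rule ccontr)
    assume "a l l \<noteq> 0"
    then have "(l, l) \<in> edges G" using that W by (auto simp: edges_def T_def V)
    then have "cycle G [l, l]" by (simp add: cycle_def walk_iff_successively)
    then show False using cyc that by (auto simp: T_def)
  qed
  (* An interior vertex of a branch contributes the denominator \<lambda>, so the only pole is at 0, and
     there is none if S contains all vertices. *)
  have val: "ratfun_value (branch_sum G S i j) z (t z i j)"
    if "z \<noteq> 0 \<or> T = {}" for z i j
  proof -
    have "ratfun_defined (branch_product G us) z" if "us \<in> branches_between G S i j" for us
      using that
    proof (rule branch_product_defined[rotated 2])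
      show "ratfun_value (weight G u v) z (a u v)" if "u \<in> verts G" "v \<in> verts G" for u v
        using W that ratfun_value_const by simp
      show "z \<noteq> a l l" if "l \<in> verts G - S" for l
        using that \<open>z \<noteq> 0 \<or> T = {}\<close> loop[of l] by (auto simp: T_def V)
    qed
    then have "ratfun_value (branch_sum G S i j) z
        (\<Sum>us\<in>branches_between G S i j. ratfun_eval (branch_product G us) z)"
      unfolding branch_sum_def by (intro ratfun_value_sum ratfun_value_eval)
    then show ?thesis unfolding t_def by (metis ratfun_eval_eq)
  qed
  have rec: "t z k j = a k j + (\<Sum>l\<in>T. a k l / z * t z l j)"
    if z: "z \<noteq> 0 \<or> T = {}" and k: "k \<in> S \<union> T" and j: "j \<in> S" for z k j
  proof -
    have kj: "k \<in> verts G" "j \<in> verts G" using k j S un V by auto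
    have "branch_sum G S k j = weight G k j +
      (\<Sum>l\<in>T. weight G k l / (ratfun_var - weight G l l) * branch_sum G S l j)"
      using branch_sum_unfold[OF finV cyc kj(1) j kj(2)] by (simp add: V T_def)
    also have "\<dots> = ratfun_const (a k j) +
      (\<Sum>l\<in>T. ratfun_const (a k l) * inverse ratfun_var * branch_sum G S l j)"
    proof -
      have "weight G l l = 0" "weight G k l = ratfun_const (a k l)" if "l \<in> T" for l
        using W[of l l] W[of k l] kj that loop[OF that] by (auto simp: V T_def)
      moreover have "weight G k j = ratfun_const (a k j)" using W kj .
      ultimately show ?thesis by (simp add: divide_inverse)
    qed
    finally have eq: "branch_sum G S k j = \<dots>" .
    have "ratfun_value (branch_sum G S k j) z (a k j + (\<Sum>l\<in>T. a k l * inverse z * t z l j))"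
      unfolding eq
      by (intro ratfun_value_add ratfun_value_sum ratfun_value_mult ratfun_value_const
          ratfun_value_inverse ratfun_value_var val z) (use z in auto)
    from ratfun_value_unique[OF val[OF z] this] show ?thesis by (simp add: divide_inverse)
  qed
  have reg: "z \<in> gershgorin_region (reduced_mat A S) \<longleftrightarrow>
    (\<exists>i\<in>S. (\<forall>j\<in>S. ratfun_defined (branch_sum G S i j) z) \<and>
      cmod (z - t z i i) \<le> (\<Sum>j\<in>S - {i}. cmod (t z i j)))" for z
    unfolding reduced_mat_def G_def[symmetric] t_def
    by (subst gershgorin_region_adj_mat)
      (simp_all add: reduction_def fin branch_sum_def[symmetric] cong: bex_cong ball_cong)
  have regA: "z \<in> gershgorin_region (const_mat A) \<longleftrightarrow>
    (\<exists>i<n. cmod (z - a i i) \<le> (\<Sum>j\<in>{0..<n} - {i}. cmod (a i j)))" for z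
    unfolding gershgorin_region_const[OF assms(1)] a_def by (auto simp: atLeast0LessThan)
  have "\<mu> \<in> gershgorin_region (reduced_mat A S)" if ev: "eigenvalue A \<mu>" and \<mu>: "\<mu> \<noteq> 0" for \<mu>
  proof -
    obtain v where v: "v \<in> carrier_vec n" "v \<noteq> 0\<^sub>v n" "A *\<^sub>v v = \<mu> \<cdot>\<^sub>v v"
      using ev assms(1) unfolding eigenvalue_def eigenvector_def by auto
    define x where "x i = v $ i" for i
    have evx: "(\<Sum>m\<in>S \<union> T. a k m * x m) = \<mu> * x k" if "k \<in> S \<union> T" for k
    proof -
      have "(A *\<^sub>v v) $ k = (\<mu> \<cdot>\<^sub>v v) $ k" using v by simp
      then show ?thesis using that v(1) assms(1)
        by (simp add: un a_def x_def scalar_prod_def)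
    qed
    define d where "d k = \<mu> * x k - (\<Sum>j\<in>S. t \<mu> k j * x j)" for k
    have d: "d k = (\<Sum>l\<in>T. a k l / \<mu> * d l)" if "k \<in> S \<union> T" for k
      unfolding d_def by (rule reduced_residual[OF fin disj \<mu> rec evx]) (use that \<mu> in auto)
    have dT: "d k = 0" if k: "k \<in> T" for k
    proof -
      have "\<not> d k \<noteq> 0"
      proof (rule no_infinite_walk_off_S[OF finV cyc, where P = "\<lambda>k. d k \<noteq> 0"])
        show "k \<in> verts G - S" using k by (simp add: T_def V)
      next
        fix k assume k: "k \<in> verts G - S" and "d k \<noteq> 0"
        then have "(\<Sum>l\<in>T. a k l / \<mu> * d l) \<noteq> 0" using d[of k] by (simp add: T_def V)
        then obtain l where "l \<in> T" "a k l / \<mu> * d l \<noteq> 0" by (meson sum.neutral)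
        then show "\<exists>l\<in>verts G - S. d l \<noteq> 0 \<and> (k, l) \<in> edges G"
          using k W by (intro bexI[of _ l]) (auto simp: edges_def T_def V)
      qed
      then show ?thesis by simp
    qed
    then have d0: "\<mu> * x k = (\<Sum>j\<in>S. t \<mu> k j * x j)" if "k \<in> S \<union> T" for k
      using d[OF that] by (simp add: d_def)
    have "\<exists>i\<in>S. x i \<noteq> 0"
    proof (rule ccontr)
      assume "\<not> ?thesis"
      then have "x k = 0" if "k \<in> S \<union> T" for k using d0[OF that] \<mu> by simp
      then have "v = 0\<^sub>v n" using v(1) by (intro eq_vecI) (auto simp: un x_def)
      then show False using v(2) by simp
    qed
    then obtain i0 where "i0 \<in> S" "x i0 \<noteq> 0" by blast
    then obtain i where "i \<in> S" "cmod (\<mu> - t \<mu> i i) \<le> (\<Sum>j\<in>S - {i}. cmod (t \<mu> i j))"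
      using gershgorin_disc[OF fin(1), of i0 x "t \<mu>" \<mu>] d0 by auto
    then show ?thesis using val \<mu> unfolding reg ratfun_defined_def by blast
  qed
  moreover have "z \<in> gershgorin_region (const_mat A)"
    if z: "z \<in> gershgorin_region (reduced_mat A S)" for z
  proof (rule ccontr)
    assume "z \<notin> gershgorin_region (const_mat A)"
    then have dom: "(\<Sum>m\<in>S \<union> T - {k}. cmod (a k m)) < cmod (z - a k k)" if "k \<in> S \<union> T" for k
      using that unfolding regA un by force
    have nz: "z \<noteq> 0 \<or> T = {}"
    proof (rule ccontr)
      assume "\<not> ?thesis"
      then obtain l where "l \<in> T" "z = 0" by blast
      then have "(\<Sum>m\<in>S \<union> T - {l}. cmod (a l m)) < 0" using dom[of l] loop by simp
      then show False by (smt (verit) sum_nonneg norm_ge_zero)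
    qed
    obtain i where "i \<in> S" "cmod (z - t z i i) \<le> (\<Sum>j\<in>S - {i}. cmod (t z i j))"
      using z unfolding reg by blast
    then show False
      using schur_complement_dominant[OF fin disj rec[OF nz] loop dom] by fastforce
  qed
  ultimately show ?thesis by blast
qed

end
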